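(* For any integers $m\geq1$ and $k\geq0$ there exist rational numbers $\widetilde d_0,\dots,\widetilde d_k$ such that for all $y>0$, \[ C'_{2(m+k),2k+2}(y)=\sum_{j=0}^k \widetilde d_j\frac{d^{2j}}{dy^{2j}}\Big(C'_{2(m+k-j),2}(y)\Big). \]
   Context: Put $\tilde n=\frac{2n-1}{2}$. For integers $p$ and $m\ge1$ and real $y>0$, $C'_{p,m}(y)=\sum_{n=1}^\infty\frac{\tilde n^p}{\cosh^m(\tilde n y)}$. *)

theory Defs
  imports "HOL-Analysis.Analysis"
begin

definition ntilde :: "nat \<Rightarrow> real" where
  "ntilde n = (2 * real n - 1) / 2"

text \<open>The series starts at index 1, hence the shift by \<open>Suc\<close>. The definition is only meaningful
  for \<open>m \<ge> 1\<close> and \<open>y > 0\<close>, where the series converges absolutely.\<close>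

definition C_prime :: "int \<Rightarrow> nat \<Rightarrow> real \<Rightarrow> real" where
  "C_prime p m y = (\<Sum>n. ntilde (Suc n) powi p / cosh (ntilde (Suc n) * y) ^ m)"

end

theory Submission
  imports Defs "HOL-Real_Asymp.Real_Asymp"
begin

text \<open>Even powers of \<open>1 / cosh\<close> are polynomials in \<open>tanh\<close>, namely powers of \<open>w = 1 - t\<^sup>2\<close>, and
  differentiating \<open>Q (tanh x)\<close> amounts to applying \<open>L Q = w Q'\<close> to the polynomial \<open>Q\<close>. From
  \<open>L\<^sup>2 (w\<^sup>r) = 4 r\<^sup>2 w\<^sup>r - 2 r (2 r + 1) w\<^bsup>r+1\<^esup>\<close> one obtains by induction that \<open>w\<^bsup>k+1\<^esup>\<close> is a rational
  combination of the \<open>L\<^bsup>2j\<^esup> w\<close> for \<open>j \<le> k\<close>. Since each derivative in \<open>y\<close> of \<open>Q (tanh (x y))\<close> also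
  brings out a factor \<open>x\<close>, summing over \<open>x = n - 1/2\<close> with the right powers of \<open>x\<close> gives the
  theorem; the series may be differentiated termwise as all its terms decay exponentially.\<close>

lemma ntilde_pos [simp]: "ntilde (Suc n) > 0"
  by (simp add: ntilde_def)

text \<open>Half of the exponential decay absorbs the power, which leaves a geometric series of
  ratio \<open>exp (- (a/2))\<close>.\<close>

lemma summable_powi_exp:
  fixes p :: int and a :: real
  assumes "a > 0"
  shows "summable (\<lambda>n. ntilde (Suc n) powi p * exp (- (a * ntilde (Suc n))))"
proof (rule summable_comparison_test_bigo)
  have "(\<lambda>n. (real n + 1/2) powr real_of_int p * exp (- (a * (real n + 1/2))))
          \<in> O(\<lambda>n. exp (real n * - (a/2)))"
    using assms by real_asymp
  then have "(\<lambda>n. (real n + 1/2) powr real_of_int p * exp (- (a * (real n + 1/2))))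
          \<in> O(\<lambda>n. exp (- (a/2)) ^ n)"
    by (simp only: exp_of_nat_mult)
  moreover have "ntilde (Suc n) = real n + 1/2" for n
    by (simp add: ntilde_def add_divide_distrib)
  moreover from this have "ntilde (Suc n) powi p = (real n + 1/2) powr real_of_int p" for n
    by (simp add: powr_real_of_int')
  ultimately show "(\<lambda>n. ntilde (Suc n) powi p * exp (- (a * ntilde (Suc n)))) \<in> O(\<lambda>n. exp (- (a/2)) ^ n)"
    by simp
  show "summable (\<lambda>n. norm (exp (- (a/2)) ^ n))"
    using assms by (simp add: norm_power)
qed

definition sech2_poly :: "real poly" where
  "sech2_poly = [:1, 0, -1:]"

definition tanh_diff :: "real poly \<Rightarrow> real poly" where
  "tanh_diff Q = sech2_poly * pderiv Q"

text \<open>A family closed under differentiation in \<open>y\<close>: \<open>p\<close> rises by one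
  and \<open>tanh_diff\<close> acts on \<open>Q\<close>. Divisibility of \<open>Q\<close> by
  \<open>sech2_poly\<close> serves below as the condition for convergence at
  \<open>y > 0\<close>.\<close>

definition tanh_series :: "int \<Rightarrow> real poly \<Rightarrow> real \<Rightarrow> real" where
  "tanh_series p Q y = (\<Sum>n. ntilde (Suc n) powi p * poly Q (tanh (ntilde (Suc n) * y)))"

lemma poly_sech2_poly: "poly sech2_poly t = 1 - t\<^sup>2"
  by (simp add: sech2_poly_def power2_eq_square)

lemma poly_sech2_poly_tanh: "poly sech2_poly (tanh x) = 1 / cosh x ^ 2" for x :: real
  using cosh_real_nonzero[of x]
  by (simp add: poly_sech2_poly tanh_def power_divide sinh_square_eq diff_divide_distrib)

lemma sech2_poly_dvd_tanh_diff [simp]: "sech2_poly dvd tanh_diff Q"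
  by (simp add: tanh_diff_def)

lemma tanh_diff_smult: "tanh_diff (smult c Q) = smult c (tanh_diff Q)"
  by (simp add: tanh_diff_def pderiv_smult)

lemma tanh_diff_sum: "tanh_diff (sum f A) = (\<Sum>i\<in>A. tanh_diff (f i))"
  by (induction A rule: infinite_finite_induct)
    (simp_all add: tanh_diff_def pderiv_add distrib_left)

lemma sech2_poly_dvd_funpow_tanh_diff: "sech2_poly dvd (tanh_diff ^^ n) sech2_poly"
  by (cases n) simp_all

text \<open>With \<open>w = 1 - t^2\<close> and \<open>s = r + 1\<close>, one application gives
  \<open>-2 s t w^s\<close>. A second one produces \<open>t^2\<close>, and replacing it by
  \<open>1 - w\<close> leaves only powers of \<open>w\<close>.\<close>

lemma tanh_diff_twice_power:
  "tanh_diff (tanh_diff (sech2_poly ^ Suc r)) =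
     smult (4 * (real r + 1)\<^sup>2) (sech2_poly ^ Suc r) -
     smult ((2 * real r + 2) * (2 * real r + 3)) (sech2_poly ^ Suc (Suc r))"
proof -
  have d: "pderiv sech2_poly = [:0, -2:]"
    by (simp add: sech2_poly_def pderiv_pCons)
  have p: "poly (pderiv (sech2_poly ^ Suc n)) t = (real n + 1) * (1 - t\<^sup>2) ^ n * (- 2 * t)" for n t
    by (simp add: pderiv_power_Suc d poly_sech2_poly algebra_simps del: power_Suc)
  \<comment> \<open>Real polynomials are determined by their values, so identities between them are
    checked pointwise.\<close>
  have E: "tanh_diff (sech2_poly ^ Suc r) = smult (real r + 1) (sech2_poly ^ Suc r * [:0, -2:])"
    by (intro poly_eq_poly_eq_iff[THEN iffD1] ext)
      (simp add: tanh_diff_def p[unfolded power_Suc] poly_sech2_poly)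
  have q: "poly (pderiv (sech2_poly ^ Suc r * [:0, -2:])) t =
      (real r + 1) * (1 - t\<^sup>2) ^ r * (- 2 * t) * (- 2 * t) - 2 * (1 - t\<^sup>2) ^ Suc r" for t
    unfolding pderiv_mult poly_add poly_mult p by (simp add: pderiv_pCons poly_sech2_poly)
  show ?thesis
    unfolding E tanh_diff_smult
    by (intro poly_eq_poly_eq_iff[THEN iffD1] ext)
      (simp only: tanh_diff_def q poly_smult poly_mult poly_diff poly_power poly_sech2_poly,
        simp add: algebra_simps power2_eq_square)
qed

lemma smult_sum_right: "smult c (sum f A) = (\<Sum>i\<in>A. smult c (f i))"
  by (induction A rule: infinite_finite_induct) (simp_all add: smult_add_right)

text \<open>The formula for two applications of \<open>tanh_diff\<close> is solved for the higher
  power. Its coefficients are rational and the leading one is nonzero, so rationality passes through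
  the induction.\<close>

lemma sech2_poly_power_eq:
  "\<exists>d :: nat \<Rightarrow> rat. sech2_poly ^ Suc k =
     (\<Sum>j\<le>k. smult (of_rat (d j)) ((tanh_diff ^^ (2 * j)) sech2_poly))"
proof (induction k)
  case 0
  show ?case by (rule exI[of _ "\<lambda>_. 1"]) simp
next
  case (Suc k)
  let ?D = "\<lambda>j. (tanh_diff ^^ (2 * j)) sech2_poly"
  from Suc obtain d :: "nat \<Rightarrow> rat"
    where d: "sech2_poly ^ Suc k = (\<Sum>j\<le>k. smult (of_rat (d j)) (?D j))" by blast
  define A B :: rat where "A = 4 * (of_nat k + 1)\<^sup>2" and "B = (2 * of_nat k + 2) * (2 * of_nat k + 3)"
  have B: "of_rat B = (2 * real k + 2) * (2 * real k + 3)" and A: "of_rat A = 4 * (real k + 1)\<^sup>2"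
    by (simp_all add: A_def B_def of_rat_mult of_rat_add of_rat_power)
  have B0: "(of_rat B :: real) \<noteq> 0"
    unfolding B by (simp add: add_eq_0_iff)
  \<comment> \<open>The first summand comes from the old expansion, which has no term at
    \<open>j = Suc k\<close>. The second comes from applying \<open>tanh_diff\<close> twice to it,
    which shifts indices up by one and leaves none at \<open>j = 0\<close>.\<close>
  define d' where "d' = (\<lambda>j. (if j \<le> k then A * d j / B else 0) -
    (case j of 0 \<Rightarrow> 0 | Suc i \<Rightarrow> d i / B))"
  have "smult (of_rat B) (sech2_poly ^ Suc (Suc k)) =
      smult (of_rat A) (sech2_poly ^ Suc k) - tanh_diff (tanh_diff (sech2_poly ^ Suc k))"
    unfolding tanh_diff_twice_power A B by simp
  also have "tanh_diff (tanh_diff (sech2_poly ^ Suc k)) =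
      (\<Sum>j\<le>k. smult (of_rat (d j)) (?D (Suc j)))"
    unfolding d by (simp add: tanh_diff_sum tanh_diff_smult)
  finally have *: "smult (of_rat B) (sech2_poly ^ Suc (Suc k)) =
      (\<Sum>j\<le>k. smult (of_rat (A * d j)) (?D j)) - (\<Sum>j\<le>k. smult (of_rat (d j)) (?D (Suc j)))"
    unfolding d by (simp add: smult_sum_right of_rat_mult)
  have "sech2_poly ^ Suc (Suc k) = smult (1 / of_rat B) (smult (of_rat B) (sech2_poly ^ Suc (Suc k)))"
    using B0 by simp
  also have "\<dots> = (\<Sum>j\<le>k. smult (of_rat (A * d j / B)) (?D j)) -
      (\<Sum>j\<le>k. smult (of_rat (d j / B)) (?D (Suc j)))"
    unfolding * by (simp add: smult_diff_right smult_sum_right of_rat_divide of_rat_mult)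
  also have "(\<Sum>j\<le>k. smult (of_rat (A * d j / B)) (?D j)) =
      (\<Sum>j\<le>Suc k. smult (of_rat (if j \<le> k then A * d j / B else 0)) (?D j))"
    by (simp del: funpow.simps)
  also have "(\<Sum>j\<le>k. smult (of_rat (d j / B)) (?D (Suc j))) =
      (\<Sum>j\<le>Suc k. smult (of_rat (case j of 0 \<Rightarrow> 0 | Suc i \<Rightarrow> d i / B)) (?D j))"
    by (subst sum.atMost_Suc_shift) (simp del: funpow.simps)
  finally have "sech2_poly ^ Suc (Suc k) = (\<Sum>j\<le>Suc k. smult (of_rat (d' j)) (?D j))"
    by (simp only: d'_def of_rat_diff smult_diff_left sum_subtractf)
  then show ?case by blast
qed

text \<open>The cofactor of \<open>sech2_poly\<close> is bounded on \<open>[-1, 1]\<close>, where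
  \<open>tanh\<close> takes its values, and \<open>1 / cosh x ^ 2\<close> is at most
  \<open>4 * exp (- x)\<close>. Bounding by \<open>a\<close> instead of \<open>x\<close> makes the
  estimate uniform in \<open>x \<ge> a\<close>.\<close>

lemma poly_tanh_le_exp:
  assumes "sech2_poly dvd Q"
  obtains C where "\<And>x a :: real. 0 \<le> a \<Longrightarrow> a \<le> x \<Longrightarrow> \<bar>poly Q (tanh x)\<bar> \<le> C * exp (- a)"
proof -
  from assms obtain P where Q: "Q = sech2_poly * P" by blast
  have "compact (poly P ` {-1..1})"
    by (intro compact_continuous_image continuous_intros) auto
  then obtain M where M: "\<And>t. t \<in> {-1..1} \<Longrightarrow> \<bar>poly P t\<bar> \<le> M"
    by (force dest: compact_imp_bounded simp: bounded_iff)
  have "\<bar>poly Q (tanh x)\<bar> \<le> (4 * M) * exp (- a)" if "0 \<le> a" "a \<le> x" for x a :: real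
  proof -
    have "exp a \<le> exp x" using that by simp
    also have "exp x \<le> 2 * cosh x" by (simp add: cosh_def)
    also have "\<dots> \<le> 4 * cosh x ^ 2"
      using mult_mono[OF cosh_real_ge_1[of x] order.refl[of "cosh x"]] cosh_real_ge_1[of x]
      by (simp add: power2_eq_square)
    finally have "1 / cosh x ^ 2 \<le> 4 * exp (- a)"
      by (simp add: exp_minus field_simps)
    moreover have "\<bar>poly P (tanh x)\<bar> \<le> M"
      using M[of "tanh x"] tanh_real_bounds[of x] by simp
    ultimately have "1 / cosh x ^ 2 * \<bar>poly P (tanh x)\<bar> \<le> (4 * exp (- a)) * M"
      by (intro mult_mono) auto
    then show ?thesis
      by (simp add: Q poly_sech2_poly_tanh abs_mult mult_ac)
  qed
  then show ?thesis by (rule that)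
qed

lemma tanh_series_terms_bound:
  assumes "sech2_poly dvd Q" "a > 0"
  shows "\<exists>M. summable M \<and> (\<forall>n. \<forall>y\<ge>a.
    norm (ntilde (Suc n) powi p * poly Q (tanh (ntilde (Suc n) * y))) \<le> M n)"
proof -
  obtain C where C: "\<And>x b :: real. 0 \<le> b \<Longrightarrow> b \<le> x \<Longrightarrow> \<bar>poly Q (tanh x)\<bar> \<le> C * exp (- b)"
    using poly_tanh_le_exp[OF assms(1)] by blast
  show ?thesis
  proof (intro exI conjI allI impI)
    show "summable (\<lambda>n. C * (ntilde (Suc n) powi p * exp (- (a * ntilde (Suc n)))))"
      by (intro summable_mult summable_powi_exp assms)
    fix n y assume "y \<ge> a"
    then have "\<bar>poly Q (tanh (ntilde (Suc n) * y))\<bar> \<le> C * exp (- (a * ntilde (Suc n)))"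
      using assms by (intro C) (simp_all add: mult.commute less_imp_le)
    then show "norm (ntilde (Suc n) powi p * poly Q (tanh (ntilde (Suc n) * y)))
        \<le> C * (ntilde (Suc n) powi p * exp (- (a * ntilde (Suc n))))"
      by (simp add: abs_mult power_int_abs mult.left_commute[of C] mult_left_mono less_imp_le)
  qed
qed

lemma summable_tanh_series:
  assumes "sech2_poly dvd Q" "y > 0"
  shows "summable (\<lambda>n. ntilde (Suc n) powi p * poly Q (tanh (ntilde (Suc n) * y)))"
proof -
  obtain M where M: "summable M"
    "\<forall>n. \<forall>z\<ge>y. norm (ntilde (Suc n) powi p * poly Q (tanh (ntilde (Suc n) * z))) \<le> M n"
    using tanh_series_terms_bound[OF assms, of p] by (elim exE conjE)
  show ?thesis
    by (rule summable_comparison_test'[OF M(1), of 0]) (rule M(2)[rule_format, OF order.refl])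
qed

lemma has_field_derivative_tanh_series:
  assumes Q: "sech2_poly dvd Q" and y: "y > 0"
  shows "(tanh_series p Q has_field_derivative tanh_series (p + 1) (tanh_diff Q) y) (at y)"
proof -
  \<comment> \<open>The half-line from \<open>y / 2\<close> has \<open>y\<close> in its interior yet
    stays away from 0, so one majorant serves all of it.\<close>
  obtain M where M: "summable M" "\<forall>n. \<forall>z\<ge>y / 2.
      norm (ntilde (Suc n) powi (p + 1) * poly (tanh_diff Q) (tanh (ntilde (Suc n) * z))) \<le> M n"
    using tanh_series_terms_bound[OF sech2_poly_dvd_tanh_diff half_gt_zero[OF y], of "p + 1" Q]
    by (elim exE conjE)
  show ?thesis
    unfolding tanh_series_def
  proof (rule has_field_derivative_series'(2))
    show "convex {y / 2..}" by simp
    show "uniformly_convergent_on {y / 2..} (\<lambda>n z. \<Sum>i<n.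
        ntilde (Suc i) powi (p + 1) * poly (tanh_diff Q) (tanh (ntilde (Suc i) * z)))"
      by (rule Weierstrass_m_test') (rule M(2)[rule_format], simp, rule M(1))
    show "summable (\<lambda>n. ntilde (Suc n) powi p * poly Q (tanh (ntilde (Suc n) * y)))"
      by (intro summable_tanh_series assms)
    show "y \<in> {y / 2..}" "y \<in> interior {y / 2..}" using y by auto
    fix n z
    have "ntilde (Suc n) powi (p + 1) = ntilde (Suc n) powi p * ntilde (Suc n)"
      by (intro power_int_add_1 disjI1 less_imp_neq[symmetric] ntilde_pos)
    then show "((\<lambda>z. ntilde (Suc n) powi p * poly Q (tanh (ntilde (Suc n) * z))) has_field_derivative
        ntilde (Suc n) powi (p + 1) * poly (tanh_diff Q) (tanh (ntilde (Suc n) * z)))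
        (at z within {y / 2..})"
      by (auto intro!: derivative_eq_intros DERIV_chain2[OF poly_DERIV]
          simp: tanh_diff_def poly_sech2_poly)
  qed
qed

lemma higher_deriv_tanh_series:
  assumes "sech2_poly dvd Q" "y > 0"
  shows "(deriv ^^ n) (tanh_series p Q) y = tanh_series (p + int n) ((tanh_diff ^^ n) Q) y"
  using assms(2)
proof (induction n arbitrary: y)
  case (Suc n)
  have "sech2_poly dvd (tanh_diff ^^ n) Q"
    using assms(1) by (cases n) simp_all
  note D = has_field_derivative_tanh_series[OF this Suc.prems, of "p + int n"]
  \<comment> \<open>The induction hypothesis covers only positive arguments; these form a
    neighbourhood of \<open>y\<close>, which suffices to differentiate the equation.\<close>
  have "eventually (\<lambda>z. z \<in> {0<..}) (nhds y)"
    using Suc.prems by (intro eventually_nhds_in_open) auto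
  then have "eventually (\<lambda>z. (deriv ^^ n) (tanh_series p Q) z =
      tanh_series (p + int n) ((tanh_diff ^^ n) Q) z) (nhds y)"
    by eventually_elim (simp add: Suc.IH)
  then have "deriv ((deriv ^^ n) (tanh_series p Q)) y =
      deriv (tanh_series (p + int n) ((tanh_diff ^^ n) Q)) y"
    by (rule deriv_cong_ev) simp
  also have "\<dots> = tanh_series (p + int n + 1) (tanh_diff ((tanh_diff ^^ n) Q)) y"
    by (rule DERIV_imp_deriv[OF D])
  finally show ?case by (simp add: add_ac)
qed simp

lemma tanh_series_sum:
  assumes "\<And>j. j \<in> A \<Longrightarrow> sech2_poly dvd Q j" "y > 0"
  shows "tanh_series p (\<Sum>j\<in>A. smult (c j) (Q j)) y = (\<Sum>j\<in>A. c j * tanh_series p (Q j) y)"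
proof -
  have "tanh_series p (\<Sum>j\<in>A. smult (c j) (Q j)) y =
      (\<Sum>n. \<Sum>j\<in>A. c j * (ntilde (Suc n) powi p * poly (Q j) (tanh (ntilde (Suc n) * y))))"
    by (simp add: tanh_series_def poly_sum sum_distrib_left mult.left_commute)
  also have "\<dots> = (\<Sum>j\<in>A. c j * tanh_series p (Q j) y)"
    unfolding tanh_series_def using assms
    by (subst suminf_sum) (auto intro!: summable_mult summable_tanh_series sum.cong suminf_mult)
  finally show ?thesis .
qed

text \<open>The terms agree at every real \<open>y\<close>, so this is an equality of functions and
  may be used inside \<open>deriv\<close>.\<close>

lemma C_prime_eq_tanh_series: "C_prime p (2 * r) = tanh_series p (sech2_poly ^ r)"
  by (simp add: fun_eq_iff C_prime_def tanh_series_def poly_sech2_poly_tanh power_divide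
      flip: power_mult)

theorem theorem4p12:
  fixes m k :: nat
  assumes "m \<ge> 1"
  shows "\<exists>d :: nat \<Rightarrow> rat. \<forall>y::real. y > 0 \<longrightarrow>
    C_prime (2 * (int m + int k)) (2 * k + 2) y =
      (\<Sum>j=0..k. of_rat (d j) *
        (deriv ^^ (2 * j)) (C_prime (2 * (int m + int k - int j)) 2) y)"
proof -
  obtain d :: "nat \<Rightarrow> rat" where d: "sech2_poly ^ Suc k =
      (\<Sum>j\<le>k. smult (of_rat (d j)) ((tanh_diff ^^ (2 * j)) sech2_poly))"
    using sech2_poly_power_eq by blast
  have C: "C_prime p 2 = tanh_series p sech2_poly" for p
    using C_prime_eq_tanh_series[of p 1] by (simp only: mult_1_right power_one_right)
  have "C_prime (2 * (int m + int k)) (2 * k + 2) y =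
      (\<Sum>j=0..k. of_rat (d j) * (deriv ^^ (2 * j)) (C_prime (2 * (int m + int k - int j)) 2) y)"
    if y: "y > 0" for y
  proof -
    have "C_prime (2 * (int m + int k)) (2 * k + 2) y =
        tanh_series (2 * (int m + int k)) (sech2_poly ^ Suc k) y"
      using C_prime_eq_tanh_series[of _ "Suc k"] by simp
    also have "\<dots> = (\<Sum>j\<le>k. of_rat (d j) *
        tanh_series (2 * (int m + int k)) ((tanh_diff ^^ (2 * j)) sech2_poly) y)"
      unfolding d using y by (intro tanh_series_sum sech2_poly_dvd_funpow_tanh_diff)
    \<comment> \<open>Differentiating \<open>2 * j\<close> times raises the exponent
      \<open>2 * (m + k - j)\<close> to \<open>2 * (m + k)\<close>, the same for every
      \<open>j\<close>.\<close>
    also have "\<dots> = (\<Sum>j\<le>k. of_rat (d j) *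
        (deriv ^^ (2 * j)) (C_prime (2 * (int m + int k - int j)) 2) y)"
      using y by (simp add: C higher_deriv_tanh_series algebra_simps)
    finally show ?thesis by (simp only: atMost_atLeast0)
  qed
  then show ?thesis by blast
qed

end
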